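(* For every grid $\theta\in\Theta$ and every real $q$, the box sums $\Psi_\mu$ generate the generalized dimensions $D^\pm_\mu(q)$ of $\mu$. That is, for $q\neq 1$, $$D^+_\mu(q)=\limsup_{\varepsilon\to0}\frac{1}{q-1}\frac{\log \Psi_\mu(\theta,\varepsilon,q)}{\log\varepsilon},\qquad D^-_\mu(q)=\liminf_{\varepsilon\to0}\frac{1}{q-1}\frac{\log \Psi_\mu(\theta,\varepsilon,q)}{\log\varepsilon},$$ and for $q=1$, $$D^+_\mu(1)=\limsup_{\varepsilon\to0}\frac{\Psi^l_\mu(\theta,\varepsilon)}{\log\varepsilon},\qquad D^-_\mu(1)=\liminf_{\varepsilon\to0}\frac{\Psi^l_\mu(\theta,\varepsilon)}{\log\varepsilon}.$$
   Context: Setting: $X\subset\mathbb{R}^n$ is a compact metric space (Euclidean distance), $T:X\to X$ is a map preserving a probability measure $\mu$ on a suitable sigma-algebra $\mathcal{A}$ of subsets of $X$ (containing balls and boxes), and $(X,T,\mathcal{A},\mu)$ is ergodic. $B_\varepsilon(x)$ is the ball of radius $\varepsilon$ centered at $x$. Generalized dimensions of $\mu$: for $q\ne1$ let $\Gamma_\mu(\varepsilon,q)=\int_X[\mu(B_\varepsilon(x))]^{q-1}\,d\mu(x)$, and let $\Gamma^l_\mu(\varepsilon)=\int_X\log[\mu(B_\varepsilon(x))]\,d\mu(x)$. For $q\neq1$, $D^+_\mu(q)$ and $D^-_\mu(q)$ are respectively the limsup and the liminf, as $\varepsilon\to0$, of $\frac{1}{q-1}\frac{\log\Gamma_\mu(\varepsilon,q)}{\log\varepsilon}$;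 for $q=1$ they are the limsup and liminf of $\Gamma^l_\mu(\varepsilon)/\log\varepsilon$. Grids: a grid $\theta$ is a choice of an origin and an orthonormal orientation in $\mathbb{R}^n$; $\Theta$ is the set of all grids. For each $\varepsilon>0$, $\theta$ determines the lattice partition into hypercubic (half-open) boxes $A_j$, $j=0,1,\dots$, of side $\varepsilon$, with the origin of $\theta$ as a box corner and sides along the directions of $\theta$ (the dependence of $A_j$ on $\theta,\varepsilon$ is implicit). $\overline{A}_j$ denotes the box of side $3\varepsilon$ with the same center and orientation as $A_j$ (the union of $A_j$ and its neighbouring boxes). Boxes are understood intersected with $X$ when measured. Box sums: $\Psi_\mu(\theta,\varepsilon,q)=\sum_{j:\,\mu(A_j)>0}\mu(A_j)\,\mu(\overline{A}_j)^{q-1}$ for $q\ne1$, and $\Psi^l_\mu(\theta,\varepsilon)=\sum_{j:\,\mu(A_j)>0}\mu(A_j)\log[\mu(\overline{A}_j)]$. *)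

theory Defs
  imports "HOL-Probability.Probability"
begin

text \<open>The phase space is the \<^const>\<open>space\<close> of a measure on \<^typ>\<open>real^'n\<close>.
  The measure need not be given on the Borel sets, so \<^term>\<open>T\<close> is measurable with respect to
  the \<open>\<sigma>\<close>-algebra of \<^term>\<open>M\<close> itself.\<close>

definition measure_preserving :: "'a measure \<Rightarrow> ('a \<Rightarrow> 'a) \<Rightarrow> bool" where
  "measure_preserving M T \<longleftrightarrow>
     T \<in> measurable M M \<and> (\<forall>A\<in>sets M. emeasure M (T -` A \<inter> space M) = emeasure M A)"

definition ergodic :: "'a measure \<Rightarrow> ('a \<Rightarrow> 'a) \<Rightarrow> bool" where
  "ergodic M T \<longleftrightarrow>
     (\<forall>A\<in>sets M. T -` A \<inter> space M = A \<longrightarrow> measure M A = 0 \<or> measure M A = 1)"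

definition ball_measure :: "(real^'n) measure \<Rightarrow> real \<Rightarrow> real^'n \<Rightarrow> real" where
  "ball_measure M \<epsilon> x = measure M (ball x \<epsilon> \<inter> space M)"

text \<open>When the space is compact, the points with a null ball of radius \<open>\<epsilon> > 0\<close> form a null set,
  and off that set the measures of these balls are bounded away from \<open>0\<close>. Hence both integrands below
  are essentially bounded for every \<open>q\<close>, and the conventions \<open>0 powr a = 0\<close> and \<open>ln 0 = 0\<close> do not
  influence the integrals.\<close>

definition Gamma_corr :: "(real^'n) measure \<Rightarrow> real \<Rightarrow> real \<Rightarrow> real" where
  "Gamma_corr M \<epsilon> q = (\<integral>x. ball_measure M \<epsilon> x powr (q - 1) \<partial>M)"

definition Gamma_log :: "(real^'n) measure \<Rightarrow> real \<Rightarrow> real" where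
  "Gamma_log M \<epsilon> = (\<integral>x. ln (ball_measure M \<epsilon> x) \<partial>M)"

text \<open>The limits are taken in \<^typ>\<open>ereal\<close>, since the dimensions can be infinite.\<close>

definition upper_dim :: "(real^'n) measure \<Rightarrow> real \<Rightarrow> ereal" where
  "upper_dim M q =
     (if q = 1 then Limsup (at_right 0) (\<lambda>\<epsilon>. ereal (Gamma_log M \<epsilon> / ln \<epsilon>))
      else Limsup (at_right 0) (\<lambda>\<epsilon>. ereal (1 / (q - 1) * (ln (Gamma_corr M \<epsilon> q) / ln \<epsilon>))))"

definition lower_dim :: "(real^'n) measure \<Rightarrow> real \<Rightarrow> ereal" where
  "lower_dim M q =
     (if q = 1 then Liminf (at_right 0) (\<lambda>\<epsilon>. ereal (Gamma_log M \<epsilon> / ln \<epsilon>))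
      else Liminf (at_right 0) (\<lambda>\<epsilon>. ereal (1 / (q - 1) * (ln (Gamma_corr M \<epsilon> q) / ln \<epsilon>))))"

text \<open>A grid is a pair of an origin and an orthogonal matrix whose rows are the directions of the
  grid; \<^term>\<open>grid_coord \<theta> x\<close> is the coordinate vector of \<^term>\<open>x\<close> with respect to the grid.\<close>

type_synonym 'n grid = "(real^'n) \<times> (real^'n^'n)"

definition grids :: "('n::finite) grid set" where
  "grids = {(p, Q). orthogonal_matrix Q}"

definition grid_coord :: "('n::finite) grid \<Rightarrow> real^'n \<Rightarrow> real^'n" where
  "grid_coord \<theta> x = snd \<theta> *v (x - fst \<theta>)"

text \<open>The boxes \<open>A\<^sub>j\<close> are indexed by integer vectors instead of by \<open>j = 0, 1, \<dots>\<close>.\<close>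

definition grid_box :: "('n::finite) grid \<Rightarrow> real \<Rightarrow> int^'n \<Rightarrow> (real^'n) set" where
  "grid_box \<theta> \<epsilon> k =
     {x. \<forall>i. \<epsilon> * of_int (k $ i) \<le> grid_coord \<theta> x $ i \<and>
             grid_coord \<theta> x $ i < \<epsilon> * (of_int (k $ i) + 1)}"

definition big_box :: "('n::finite) grid \<Rightarrow> real \<Rightarrow> int^'n \<Rightarrow> (real^'n) set" where
  "big_box \<theta> \<epsilon> k =
     {x. \<forall>i. \<epsilon> * (of_int (k $ i) - 1) \<le> grid_coord \<theta> x $ i \<and>
             grid_coord \<theta> x $ i < \<epsilon> * (of_int (k $ i) + 2)}"

lemma big_box_eq_Union:
  assumes "\<epsilon> > 0"
  shows "big_box \<theta> \<epsilon> k = (\<Union>l\<in>{l. \<forall>i. \<bar>l $ i - k $ i\<bar> \<le> 1}. grid_box \<theta> \<epsilon> l)"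
proof (intro set_eqI iffI)
  fix x assume "x \<in> big_box \<theta> \<epsilon> k"
  then have x: "\<epsilon> * (of_int (k $ i) - 1) \<le> grid_coord \<theta> x $ i"
    "grid_coord \<theta> x $ i < \<epsilon> * (of_int (k $ i) + 2)" for i
    by (auto simp: big_box_def)
  define l where "l = (\<chi> i. \<lfloor>grid_coord \<theta> x $ i / \<epsilon>\<rfloor>)"
  have "\<bar>l $ i - k $ i\<bar> \<le> 1" for i
  proof -
    have "of_int (k $ i) - 1 \<le> grid_coord \<theta> x $ i / \<epsilon>" "grid_coord \<theta> x $ i / \<epsilon> < of_int (k $ i) + 2"
      using x[of i] assms by (auto simp: field_simps)
    then show ?thesis
      unfolding l_def vec_lambda_beta by linarith
  qed
  moreover have "x \<in> grid_box \<theta> \<epsilon> l"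
  proof -
    have "\<epsilon> * of_int (l $ i) \<le> grid_coord \<theta> x $ i \<and> grid_coord \<theta> x $ i < \<epsilon> * (of_int (l $ i) + 1)" for i
    proof -
      have "of_int (l $ i) \<le> grid_coord \<theta> x $ i / \<epsilon>" "grid_coord \<theta> x $ i / \<epsilon> < of_int (l $ i) + 1"
        unfolding l_def vec_lambda_beta by linarith+
      then show ?thesis
        using assms by (auto simp: field_simps)
    qed
    then show ?thesis by (simp add: grid_box_def)
  qed
  ultimately show "x \<in> (\<Union>l\<in>{l. \<forall>i. \<bar>l $ i - k $ i\<bar> \<le> 1}. grid_box \<theta> \<epsilon> l)"
    by blast
next
  fix x assume "x \<in> (\<Union>l\<in>{l. \<forall>i. \<bar>l $ i - k $ i\<bar> \<le> 1}. grid_box \<theta> \<epsilon> l)"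
  then obtain l where l: "\<And>i. \<bar>l $ i - k $ i\<bar> \<le> 1" and x: "x \<in> grid_box \<theta> \<epsilon> l"
    by blast
  show "x \<in> big_box \<theta> \<epsilon> k"
    unfolding big_box_def
  proof (intro CollectI allI conjI)
    fix i
    have "of_int (k $ i) - 1 \<le> (of_int (l $ i) :: real)" "of_int (l $ i) + 1 \<le> (of_int (k $ i) + 2 :: real)"
      using l[of i] by linarith+
    then have "\<epsilon> * (of_int (k $ i) - 1) \<le> \<epsilon> * of_int (l $ i)"
      "\<epsilon> * (of_int (l $ i) + 1) \<le> \<epsilon> * (of_int (k $ i) + 2)"
      using assms by (auto intro: mult_left_mono)
    then show "\<epsilon> * (of_int (k $ i) - 1) \<le> grid_coord \<theta> x $ i"
      "grid_coord \<theta> x $ i < \<epsilon> * (of_int (k $ i) + 2)"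
      using x unfolding grid_box_def by (auto intro: order_trans less_le_trans)
  qed
qed

definition box_measure :: "(real^'n) measure \<Rightarrow> 'n grid \<Rightarrow> real \<Rightarrow> int^'n \<Rightarrow> real" where
  "box_measure M \<theta> \<epsilon> k = measure M (grid_box \<theta> \<epsilon> k \<inter> space M)"

definition big_box_measure :: "(real^'n) measure \<Rightarrow> 'n grid \<Rightarrow> real \<Rightarrow> int^'n \<Rightarrow> real" where
  "big_box_measure M \<theta> \<epsilon> k = measure M (big_box \<theta> \<epsilon> k \<inter> space M)"

text \<open>For a bounded space only finitely many boxes have positive measure, so the sums are finite.\<close>

definition Psi_sum :: "(real^'n) measure \<Rightarrow> 'n grid \<Rightarrow> real \<Rightarrow> real \<Rightarrow> real" where
  "Psi_sum M \<theta> \<epsilon> q =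
     (\<Sum>\<^sub>\<infinity>k\<in>{k. box_measure M \<theta> \<epsilon> k > 0}.
        box_measure M \<theta> \<epsilon> k * big_box_measure M \<theta> \<epsilon> k powr (q - 1))"

definition Psi_log :: "(real^'n) measure \<Rightarrow> 'n grid \<Rightarrow> real \<Rightarrow> real" where
  "Psi_log M \<theta> \<epsilon> =
     (\<Sum>\<^sub>\<infinity>k\<in>{k. box_measure M \<theta> \<epsilon> k > 0}.
        box_measure M \<theta> \<epsilon> k * ln (big_box_measure M \<theta> \<epsilon> k))"

end

theory Submission
  imports Defs
begin

text \<open>If \<open>x\<close> lies in the box \<open>A\<^sub>j\<close>, then the ball of radius \<open>\<epsilon>\<close> around \<open>x\<close> is contained in the enlarged
  box, which in turn is contained in the ball of radius \<open>C \<epsilon>\<close> around \<open>x\<close>, with \<open>C = 2 n\<close>. The box sum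
  is the integral over \<open>x\<close> of a monotone function of the measure of the enlarged box around \<open>x\<close>, so it
  lies between the correlation integrals at scales \<open>\<epsilon>\<close> and \<open>C \<epsilon>\<close>. Since \<open>ln (C \<epsilon>) / ln \<epsilon>\<close> tends to \<open>1\<close>,
  both integrals have the same growth exponents.\<close>

section \<open>Rescaling the argument of a logarithmic growth rate\<close>

text \<open>Multiplication by \<open>c > 0\<close> maps the filter of right neighbourhoods of 0 onto
  itself, so a fixed change of scale does not affect a limit superior at 0.\<close>

lemma Limsup_at_right_0_scale:
  fixes f :: "real \<Rightarrow> ereal" and c :: real
  assumes "c > 0"
  shows "Limsup (at_right 0) (\<lambda>x. f (c * x)) = Limsup (at_right 0) f"
proof -
  have "inj (times c)"
    using assms by (auto simp: inj_on_def)
  then have "Limsup (filtermap (times c) (at_right 0)) f = Limsup (at_right 0) (\<lambda>x. f (c * x))"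
    by (intro antisym Limsup_filtermap_le Limsup_filtermap_ge)
  then show ?thesis
    using filtermap_times_pos_at_right[OF assms, of 0] by simp
qed

lemma Liminf_at_right_0_scale:
  fixes f :: "real \<Rightarrow> ereal" and c :: real
  assumes "c > 0"
  shows "Liminf (at_right 0) (\<lambda>x. f (c * x)) = Liminf (at_right 0) f"
proof -
  have "inj (times c)"
    using assms by (auto simp: inj_on_def)
  then have "Liminf (filtermap (times c) (at_right 0)) f = Liminf (at_right 0) (\<lambda>x. f (c * x))"
    by (intro antisym Liminf_filtermap_le Liminf_filtermap_ge)
  then show ?thesis
    using filtermap_times_pos_at_right[OF assms, of 0] by simp
qed

text \<open>A quantitative form of \<open>ln (c * x) / ln x\<close> tending to 1: near 0 the
  constant \<open>ln c\<close> is at most \<open>(1 - z) * \<bar>ln x\<bar>\<close>. Both logarithms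
  are eventually negative, so the inequality bounds the size of \<open>ln (c * x)\<close> from
  below.\<close>

lemma eventually_ln_scale_ge:
  fixes c z :: real
  assumes "c \<ge> 1" "0 < z" "z < 1"
  shows "\<forall>\<^sub>F x in at_right 0. z * ln x \<ge> ln (c * x)"
proof -
  \<comment> \<open>The point where \<open>ln c\<close> equals \<open>(1 - z)\<close> times the size
    of \<open>ln d\<close>.\<close>
  define d where "d = exp (- (ln c / (1 - z)))"
  have "d > 0" by (simp add: d_def)
  have "z * ln x \<ge> ln (c * x)" if "0 < x" "x < d" for x
  proof -
    have "ln x < ln d"
      using that by simp
    then have "ln x < - (ln c / (1 - z))"
      unfolding d_def by (simp only: ln_exp)
    then have "(1 - z) * ln x < - ln c"
      using assms by (simp add: field_simps)
    then show ?thesis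
      using that assms by (simp add: ln_mult algebra_simps)
  qed
  then show ?thesis
    using \<open>d > 0\<close> unfolding eventually_at_right_field by blast
qed

text \<open>Removes the loss factor \<open>z\<close> after the passage to the limit, where the
  values may be infinite.\<close>

lemma ereal_le_of_mult_le:
  fixes a b :: ereal
  assumes "0 \<le> b" "\<And>z. 0 < z \<Longrightarrow> z < 1 \<Longrightarrow> ereal z * a \<le> b"
  shows "a \<le> b"
proof (rule ereal_le_mult_one_interval)
  fix z :: ereal
  assume "0 < z" "z < 1"
  then show "z * a \<le> b"
    using assms(2) by (cases z) auto
qed (use assms(1) in auto)

text \<open>Division by the negative \<open>ln x\<close> reverses inequalities, so the lower bound
  \<open>h x\<close> for \<open>p x\<close> gives the upper bound for its rate. The other bound
  compares \<open>p x\<close> with \<open>h (c * x)\<close>, whose natural denominator is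
  \<open>ln (c * x)\<close>; exchanging the denominators costs a factor \<open>z\<close> arbitrarily
  close to 1, and the scale \<open>c\<close> disappears in the limit.\<close>

lemma log_rate_sandwich:
  fixes h p :: "real \<Rightarrow> real" and c :: real
  assumes "c \<ge> 1"
    and le: "\<And>x. x > 0 \<Longrightarrow> h x \<le> p x" "\<And>x. x > 0 \<Longrightarrow> p x \<le> h (c * x)"
    and nonpos: "\<And>x. x > 0 \<Longrightarrow> h x \<le> 0"
  shows "Limsup (at_right 0) (\<lambda>x. ereal (h x / ln x)) = Limsup (at_right 0) (\<lambda>x. ereal (p x / ln x))"
    and "Liminf (at_right 0) (\<lambda>x. ereal (h x / ln x)) = Liminf (at_right 0) (\<lambda>x. ereal (p x / ln x))"
proof -
  define H where "H x = ereal (h x / ln x)" for x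
  define P where "P x = ereal (p x / ln x)" for x
  \<comment> \<open>Both scales stay below 1, so that both logarithms are negative.\<close>
  have small: "\<forall>\<^sub>F x in at_right 0. 0 < x \<and> x < (1::real) \<and> c * x < 1"
  proof -
    have "\<forall>\<^sub>F x in at_right 0. 0 < x \<and> x < 1 / c"
      using assms(1) by (intro eventually_at_rightI[of 0 "1 / c"]) auto
    then show ?thesis
    proof eventually_elim
      case (elim x)
      then have "c * x < 1" using assms(1) by (simp add: field_simps)
      moreover have "x \<le> c * x" using elim assms(1) by simp
      ultimately show ?case using elim by linarith
    qed
  qed
  have PH: "\<forall>\<^sub>F x in at_right 0. P x \<le> H x"
    using small
  proof eventually_elim
    case (elim x)
    then show ?case
      using le(1)[of x] by (auto simp: P_def H_def intro: divide_right_mono_neg)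
  qed
  have HP: "\<forall>\<^sub>F x in at_right 0. ereal z * H (c * x) \<le> P x" if z: "0 < z" "z < 1" for z
    using small eventually_ln_scale_ge[OF \<open>c \<ge> 1\<close> z]
  proof eventually_elim
    case (elim x)
    have ln: "ln x < 0" "ln (c * x) < 0"
      using elim assms(1) by auto
    have "h (c * x) \<le> 0" using nonpos elim assms(1) by simp
    have "z * (h (c * x) / ln (c * x)) = (- h (c * x)) * z / (- ln (c * x))" by simp
    also have "\<dots> \<le> (- h (c * x)) / (- ln x)"
    proof -
      \<comment> \<open>The comparison of logarithms may be multiplied by \<open>- h (c * x)\<close>
        because \<open>h\<close> is nonpositive.\<close>
      have "(- h (c * x)) * (z * - ln x) \<le> (- h (c * x)) * (- ln (c * x))"
        using \<open>h (c * x) \<le> 0\<close> elim by (intro mult_left_mono) auto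
      then show ?thesis
        using ln by (simp add: field_simps)
    qed
    also have "\<dots> = h (c * x) / ln x" by simp
    also have "\<dots> \<le> p x / ln x"
      using le(2)[of x] elim ln by (intro divide_right_mono_neg) auto
    finally show ?case by (simp add: H_def P_def)
  qed
  \<comment> \<open>Nonnegativity of the limits of \<open>P\<close> is what allows \<open>z\<close>
    to be removed below.\<close>
  have P0: "\<forall>\<^sub>F x in at_right 0. 0 \<le> P x"
    using small
  proof eventually_elim
    case (elim x)
    then have "p x \<le> 0"
      using order_trans[OF le(2)[of x] nonpos[of "c * x"]] assms(1) by simp
    then show ?case
      using elim by (simp add: P_def divide_nonpos_neg)
  qed
  have "c > 0" using assms(1) by simp
  have "Limsup (at_right 0) H = Limsup (at_right 0) P"
  proof (rule antisym)
    have "0 \<le> Limsup (at_right 0) P"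
      using P0 by (intro le_Limsup) auto
    moreover have "ereal z * Limsup (at_right 0) H \<le> Limsup (at_right 0) P" if "0 < z" "z < 1" for z
      using Limsup_mono[OF HP[OF that]] that
        Limsup_ereal_mult_left[of "at_right (0::real)" z "\<lambda>x. H (c * x)"]
        Limsup_at_right_0_scale[OF \<open>c > 0\<close>, of H] by simp
    ultimately show "Limsup (at_right 0) H \<le> Limsup (at_right 0) P"
      by (rule ereal_le_of_mult_le)
  qed (rule Limsup_mono[OF PH])
  moreover have "Liminf (at_right 0) H = Liminf (at_right 0) P"
  proof (rule antisym)
    have "0 \<le> Liminf (at_right 0) P"
      using P0 by (intro Liminf_bounded)
    moreover have "ereal z * Liminf (at_right 0) H \<le> Liminf (at_right 0) P" if "0 < z" "z < 1" for z
      using Liminf_mono[OF HP[OF that]] that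
        Liminf_ereal_mult_left[of "at_right (0::real)" z "\<lambda>x. H (c * x)"]
        Liminf_at_right_0_scale[OF \<open>c > 0\<close>, of H] by simp
    ultimately show "Liminf (at_right 0) H \<le> Liminf (at_right 0) P"
      by (rule ereal_le_of_mult_le)
  qed (rule Liminf_mono[OF PH])
  ultimately show "Limsup (at_right 0) (\<lambda>x. ereal (h x / ln x)) = Limsup (at_right 0) (\<lambda>x. ereal (p x / ln x))"
    and "Liminf (at_right 0) (\<lambda>x. ereal (h x / ln x)) = Liminf (at_right 0) (\<lambda>x. ereal (p x / ln x))"
    by (simp_all add: H_def[abs_def] P_def[abs_def])
qed

section \<open>Geometry of boxes and balls\<close>

lemma dist_grid_coord:
  assumes "\<theta> \<in> grids"
  shows "dist (grid_coord \<theta> x) (grid_coord \<theta> y) = dist x y"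
proof -
  obtain p Q where \<theta>: "\<theta> = (p, Q)" and Q: "orthogonal_matrix Q"
    using assms by (auto simp: grids_def)
  have "orthogonal_transformation ((*v) Q)"
    using Q by (simp add: orthogonal_transformation_matrix)
  then have "norm (Q *v v) = norm v" for v
    by (simp add: orthogonal_transformation)
  moreover have "grid_coord \<theta> x - grid_coord \<theta> y = Q *v (x - y)"
    by (simp add: \<theta> grid_coord_def matrix_vector_mult_diff_distrib)
  ultimately show ?thesis
    by (simp add: dist_norm)
qed

text \<open>The Euclidean norm is bounded by the sum of the absolute coordinates. This costs a
  factor n instead of its square root, which is harmless here, and keeps the strict inequality that
  open balls require.\<close>

lemma dist_less_of_grid_coord:
  fixes x y :: "real^'n"
  assumes "\<theta> \<in> grids" "\<And>i. \<bar>grid_coord \<theta> x $ i - grid_coord \<theta> y $ i\<bar> < r"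
  shows "dist x y < real CARD('n) * r"
proof -
  have "dist x y = norm (grid_coord \<theta> x - grid_coord \<theta> y)"
    by (metis dist_grid_coord[OF assms(1)] dist_norm)
  also have "\<dots> \<le> (\<Sum>i\<in>UNIV. \<bar>(grid_coord \<theta> x - grid_coord \<theta> y) $ i\<bar>)"
    by (rule norm_le_l1_cart)
  also have "\<dots> < (\<Sum>i\<in>(UNIV::'n set). r)"
    using assms(2) by (intro sum_strict_mono) auto
  finally show ?thesis by simp
qed

definition box_index :: "('n::finite) grid \<Rightarrow> real \<Rightarrow> real^'n \<Rightarrow> int^'n" where
  "box_index \<theta> \<epsilon> x = (\<chi> i. \<lfloor>grid_coord \<theta> x $ i / \<epsilon>\<rfloor>)"

text \<open>Because the boxes are half-open, rounding down gives the exact index: the boxes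
  partition space, and each point selects a single summand of a box sum.\<close>

lemma mem_grid_box_iff:
  assumes "\<epsilon> > 0"
  shows "x \<in> grid_box \<theta> \<epsilon> k \<longleftrightarrow> k = box_index \<theta> \<epsilon> x"
proof -
  have "(\<epsilon> * of_int (k $ i) \<le> t \<and> t < \<epsilon> * (of_int (k $ i) + 1)) \<longleftrightarrow> k $ i = \<lfloor>t / \<epsilon>\<rfloor>" for i t
  proof -
    have "(\<epsilon> * of_int (k $ i) \<le> t \<and> t < \<epsilon> * (of_int (k $ i) + 1)) \<longleftrightarrow>
      of_int (k $ i) \<le> t / \<epsilon> \<and> t / \<epsilon> < of_int (k $ i) + 1"
      using assms by (simp add: field_simps)
    then show ?thesis
      by (metis floor_correct floor_eq_iff)
  qed
  then show ?thesis
    by (simp add: grid_box_def box_index_def vec_eq_iff)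
qed

text \<open>The grid coordinates are isometric, so a displacement shorter than \<epsilon> moves each
  coordinate by less than one box side.\<close>

lemma ball_subset_big_box:
  assumes "\<theta> \<in> grids" "x \<in> grid_box \<theta> \<epsilon> k"
  shows "ball x \<epsilon> \<subseteq> big_box \<theta> \<epsilon> k"
proof
  fix y assume "y \<in> ball x \<epsilon>"
  then have "norm (grid_coord \<theta> x - grid_coord \<theta> y) < \<epsilon>"
    using dist_grid_coord[OF assms(1), of x y] by (simp add: dist_norm)
  then have d: "\<bar>grid_coord \<theta> x $ i - grid_coord \<theta> y $ i\<bar> < \<epsilon>" for i
    using component_le_norm_cart[of "grid_coord \<theta> x - grid_coord \<theta> y" i] by simp
  have "\<epsilon> * (of_int (k $ i) - 1) \<le> grid_coord \<theta> y $ i \<and> grid_coord \<theta> y $ i < \<epsilon> * (of_int (k $ i) + 2)" for i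
  proof -
    have "\<epsilon> * of_int (k $ i) \<le> grid_coord \<theta> x $ i \<and> grid_coord \<theta> x $ i < \<epsilon> * (of_int (k $ i) + 1)"
      using assms(2) by (simp add: grid_box_def)
    then show ?thesis
      using d[of i] by (simp add: algebra_simps abs_less_iff)
  qed
  then show "y \<in> big_box \<theta> \<epsilon> k"
    by (simp add: big_box_def)
qed

text \<open>Along each direction \<open>x\<close> lies in the middle third of a side of length
  3\<epsilon>, so every point of the enlarged box is less than 2\<epsilon> away in that coordinate.
  This is the source of the constant 2n.\<close>

lemma big_box_subset_ball:
  fixes x :: "real^'n"
  assumes "\<theta> \<in> grids" "x \<in> grid_box \<theta> \<epsilon> k"
  shows "big_box \<theta> \<epsilon> k \<subseteq> ball x (real CARD('n) * (2 * \<epsilon>))"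
proof
  fix y assume y: "y \<in> big_box \<theta> \<epsilon> k"
  have "\<bar>grid_coord \<theta> x $ i - grid_coord \<theta> y $ i\<bar> < 2 * \<epsilon>" for i
  proof -
    have "\<epsilon> * of_int (k $ i) \<le> grid_coord \<theta> x $ i \<and> grid_coord \<theta> x $ i < \<epsilon> * (of_int (k $ i) + 1)"
      using assms(2) by (simp add: grid_box_def)
    moreover have "\<epsilon> * (of_int (k $ i) - 1) \<le> grid_coord \<theta> y $ i \<and> grid_coord \<theta> y $ i < \<epsilon> * (of_int (k $ i) + 2)"
      using y by (simp add: big_box_def)
    ultimately show ?thesis
      by (simp add: algebra_simps abs_less_iff)
  qed
  then show "y \<in> ball x (real CARD('n) * (2 * \<epsilon>))"
    using dist_less_of_grid_coord[OF assms(1)] by auto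
qed

text \<open>Serves to bound the measure of a ball from below by the measure of a small box.\<close>

lemma grid_box_subset_ball:
  fixes x :: "real^'n"
  assumes "\<theta> \<in> grids" "x \<in> grid_box \<theta> \<epsilon> k"
  shows "grid_box \<theta> \<epsilon> k \<subseteq> ball x (real CARD('n) * \<epsilon>)"
proof
  fix y assume y: "y \<in> grid_box \<theta> \<epsilon> k"
  have "\<bar>grid_coord \<theta> x $ i - grid_coord \<theta> y $ i\<bar> < \<epsilon>" for i
  proof -
    have "\<epsilon> * of_int (k $ i) \<le> grid_coord \<theta> x $ i \<and> grid_coord \<theta> x $ i < \<epsilon> * (of_int (k $ i) + 1)"
      using assms(2) by (simp add: grid_box_def)
    moreover have "\<epsilon> * of_int (k $ i) \<le> grid_coord \<theta> y $ i \<and> grid_coord \<theta> y $ i < \<epsilon> * (of_int (k $ i) + 1)"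
      using y by (simp add: grid_box_def)
    ultimately show ?thesis
      by (simp add: algebra_simps abs_less_iff)
  qed
  then show "y \<in> ball x (real CARD('n) * \<epsilon>)"
    using dist_less_of_grid_coord[OF assms(1)] by auto
qed

lemma finite_box_index_image:
  fixes S :: "(real^'n) set"
  assumes "\<theta> \<in> grids" "bounded S" "\<epsilon> > 0"
  shows "finite (box_index \<theta> \<epsilon> ` S)"
proof -
  obtain B where B: "\<And>x. x \<in> S \<Longrightarrow> dist (fst \<theta>) x \<le> B"
    using assms(2) by (auto simp: bounded_any_center[where a = "fst \<theta>"])
  \<comment> \<open>Index vectors are viewed as functions on the finite coordinate type, with values
    in a bounded integer interval.\<close>
  have "vec_nth ` box_index \<theta> \<epsilon> ` S \<subseteq> PiE (UNIV :: 'n set) (\<lambda>_. {\<lfloor>- B / \<epsilon>\<rfloor>..\<lfloor>B / \<epsilon>\<rfloor>})"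
  proof (clarsimp simp: PiE_UNIV_domain)
    fix x i assume "x \<in> S"
    have "grid_coord \<theta> (fst \<theta>) = 0"
      by (simp add: grid_coord_def)
    then have "norm (grid_coord \<theta> x) \<le> B"
      using B[OF \<open>x \<in> S\<close>] dist_grid_coord[OF assms(1), of "fst \<theta>" x] by simp
    then have "\<bar>grid_coord \<theta> x $ i\<bar> \<le> B"
      using component_le_norm_cart[of "grid_coord \<theta> x" i] by linarith
    then show "\<lfloor>- (B / \<epsilon>)\<rfloor> \<le> box_index \<theta> \<epsilon> x $ i \<and> box_index \<theta> \<epsilon> x $ i \<le> \<lfloor>B / \<epsilon>\<rfloor>"
      unfolding box_index_def vec_lambda_beta
      using assms(3) by (intro conjI floor_mono) (auto simp: field_simps abs_le_iff)
  qed
  then have "finite (vec_nth ` box_index \<theta> \<epsilon> ` S)"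
    by (rule finite_subset) (intro finite_PiE; simp)
  then show ?thesis
    by (rule finite_imageD) (simp add: inj_on_def vec_nth_inject)
qed

section \<open>Measures defined on all boxes\<close>

text \<open>The \<sigma>-algebra is not assumed to be the Borel one; measurability of the boxes of
  all grids is its link to the topology.\<close>

locale box_prob_space = prob_space M for M :: "(real^'n) measure" +
  assumes compact_space: "compact (space M)"
    and grid_box_sets: "\<And>\<theta> \<epsilon> k. \<theta> \<in> grids \<Longrightarrow> \<epsilon> > 0 \<Longrightarrow> grid_box \<theta> \<epsilon> k \<inter> space M \<in> sets M"
begin

section \<open>Measurability of Borel traces and of ball measures\<close>

lemma id_borel_measurable: "(\<lambda>x. x) \<in> borel_measurable M"
proof -
  \<comment> \<open>The half-space \<open>{x. a \<le> x $ i}\<close> is a union of unit boxes of the grid with origin \<open>(a, \<dots>, a)\<close>.\<close>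
  have "(\<lambda>x. x $ i) \<in> borel_measurable M" for i
  proof (rule borel_measurableI_ge)
    fix a :: real
    define \<theta> :: "'n grid" where "\<theta> = ((\<chi> j. a), mat 1)"
    have \<theta>: "\<theta> \<in> grids"
      by (simp add: \<theta>_def grids_def orthogonal_matrix_id)
    have coord: "grid_coord \<theta> x $ j = x $ j - a" for x j
      by (simp add: \<theta>_def grid_coord_def)
    have "{x \<in> space M. a \<le> x $ i} = (\<Union>k\<in>{k. k $ i \<ge> 0}. grid_box \<theta> 1 k \<inter> space M)"
    proof -
      have "a \<le> x $ i \<longleftrightarrow> (\<exists>k. 0 \<le> k $ i \<and> x \<in> grid_box \<theta> 1 k)" for x
        by (simp add: mem_grid_box_iff box_index_def coord)
      then show ?thesis by auto
    qed
    also have "\<dots> \<in> sets M"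
      using grid_box_sets[OF \<theta>] by (intro sets.countable_UN') auto
    finally show "{x \<in> space M. a \<le> x $ i} \<in> sets M" .
  qed
  then show ?thesis
    by (subst borel_measurable_euclidean_space) (auto simp: Basis_vec_def inner_axis)
qed

lemma Int_space_sets:
  assumes "A \<in> sets borel"
  shows "A \<inter> space M \<in> sets M"
  using measurable_sets[OF id_borel_measurable assms] by simp

text \<open>The balls are the sections of the set of pairs at distance less than \<epsilon>. That
  set is measurable in the product, so the measure of its sections is a measurable function.\<close>

lemma ball_measure_borel: "ball_measure M \<epsilon> \<in> borel_measurable M"
proof -
  have "(\<lambda>p. dist (fst p) (snd p)) \<in> borel_measurable (M \<Otimes>\<^sub>M M)"
    by (intro borel_measurable_dist measurable_compose[OF measurable_fst id_borel_measurable]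
        measurable_compose[OF measurable_snd id_borel_measurable])
  then have "{p \<in> space (M \<Otimes>\<^sub>M M). dist (fst p) (snd p) < \<epsilon>} \<in> sets (M \<Otimes>\<^sub>M M)"
    by measurable
  then have "(\<lambda>x. emeasure M (Pair x -` {p \<in> space (M \<Otimes>\<^sub>M M). dist (fst p) (snd p) < \<epsilon>})) \<in> borel_measurable M"
    by (rule measurable_emeasure_Pair)
  then have "(\<lambda>x. enn2real (emeasure M (Pair x -` {p \<in> space (M \<Otimes>\<^sub>M M). dist (fst p) (snd p) < \<epsilon>}))) \<in> borel_measurable M"
    by measurable
  also have "?this \<longleftrightarrow> ?thesis"
  proof (rule measurable_cong)
    fix x assume "x \<in> space M"
    then have "Pair x -` {p \<in> space (M \<Otimes>\<^sub>M M). dist (fst p) (snd p) < \<epsilon>} = ball x \<epsilon> \<inter> space M"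
      by (auto simp: space_pair_measure)
    then show "enn2real (emeasure M (Pair x -` {p \<in> space (M \<Otimes>\<^sub>M M). dist (fst p) (snd p) < \<epsilon>})) = ball_measure M \<epsilon> x"
      by (simp add: ball_measure_def measure_def)
  qed
  finally show ?thesis .
qed

lemma big_box_sets:
  assumes "\<theta> \<in> grids" "\<epsilon> > 0"
  shows "big_box \<theta> \<epsilon> k \<inter> space M \<in> sets M"
proof -
  have "big_box \<theta> \<epsilon> k \<inter> space M =
    (\<Union>l\<in>{l. \<forall>i. \<bar>l $ i - k $ i\<bar> \<le> 1}. grid_box \<theta> \<epsilon> l \<inter> space M)"
    unfolding big_box_eq_Union[OF assms(2)] by auto
  also have "\<dots> \<in> sets M"
    using grid_box_sets[OF assms] by (intro sets.countable_UN') auto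
  finally show ?thesis .
qed

section \<open>Box sums as integrals\<close>

lemma finite_positive_boxes:
  assumes "\<theta> \<in> grids" "\<epsilon> > 0"
  shows "finite {k. box_measure M \<theta> \<epsilon> k > 0}"
proof (rule finite_subset)
  show "{k. box_measure M \<theta> \<epsilon> k > 0} \<subseteq> box_index \<theta> \<epsilon> ` space M"
  proof
    fix k assume "k \<in> {k. box_measure M \<theta> \<epsilon> k > 0}"
    then have "grid_box \<theta> \<epsilon> k \<inter> space M \<noteq> {}"
      unfolding box_measure_def by force
    then show "k \<in> box_index \<theta> \<epsilon> ` space M"
      by (auto simp: mem_grid_box_iff[OF assms(2)])
  qed
  show "finite (box_index \<theta> \<epsilon> ` space M)"
    using assms compact_space by (intro finite_box_index_image compact_imp_bounded)
qed

text \<open>There are only countably many boxes, so the null ones together form a null set.\<close>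

lemma AE_box_index_positive:
  assumes "\<theta> \<in> grids" "\<epsilon> > 0"
  shows "AE x in M. box_measure M \<theta> \<epsilon> (box_index \<theta> \<epsilon> x) > 0"
proof -
  have "AE x in M. box_measure M \<theta> \<epsilon> k = 0 \<longrightarrow> x \<notin> grid_box \<theta> \<epsilon> k" for k
  proof (cases "box_measure M \<theta> \<epsilon> k = 0")
    case True
    then have "grid_box \<theta> \<epsilon> k \<inter> space M \<in> null_sets M"
      using grid_box_sets[OF assms] by (intro null_setsI) (auto simp: box_measure_def emeasure_eq_measure)
    then have "AE x in M. x \<notin> grid_box \<theta> \<epsilon> k \<inter> space M"
      by (rule AE_not_in)
    with AE_space show ?thesis
      by eventually_elim auto
  qed simp
  then have "AE x in M. \<forall>k. box_measure M \<theta> \<epsilon> k = 0 \<longrightarrow> x \<notin> grid_box \<theta> \<epsilon> k"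
    by (simp add: AE_all_countable)
  then show ?thesis
  proof eventually_elim
    case (elim x)
    then have "box_measure M \<theta> \<epsilon> (box_index \<theta> \<epsilon> x) \<noteq> 0"
      using mem_grid_box_iff[OF assms(2)] by blast
    then show ?case
      by (simp add: box_measure_def zero_less_measure_iff)
  qed
qed

text \<open>A box sum is the integral of a finite combination of indicators. The second claim
  identifies this combination almost everywhere with \<open>f\<close> at the box of
  \<open>x\<close>, which allows pointwise comparison with balls around \<open>x\<close>.\<close>

lemma has_bochner_integral_box_index:
  fixes f :: "int^'n \<Rightarrow> real"
  assumes "\<theta> \<in> grids" "\<epsilon> > 0"
  shows "has_bochner_integral M (\<lambda>x. \<Sum>k | box_measure M \<theta> \<epsilon> k > 0. f k * indicator (grid_box \<theta> \<epsilon> k \<inter> space M) x)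
      (\<Sum>\<^sub>\<infinity>k\<in>{k. box_measure M \<theta> \<epsilon> k > 0}. box_measure M \<theta> \<epsilon> k * f k)" (is ?integral)
    and "AE x in M. (\<Sum>k | box_measure M \<theta> \<epsilon> k > 0. f k * indicator (grid_box \<theta> \<epsilon> k \<inter> space M) x) =
      f (box_index \<theta> \<epsilon> x)" (is ?AE)
proof -
  let ?K = "{k. box_measure M \<theta> \<epsilon> k > 0}"
  have "has_bochner_integral M (\<lambda>x. \<Sum>k\<in>?K. f k * indicator (grid_box \<theta> \<epsilon> k \<inter> space M) x)
    (\<Sum>k\<in>?K. f k * box_measure M \<theta> \<epsilon> k)"
    unfolding box_measure_def using grid_box_sets[OF assms]
    by (intro has_bochner_integral_sum has_bochner_integral_mult_right has_bochner_integral_real_indicator)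
      (auto simp: emeasure_eq_measure)
  then show ?integral
    using finite_positive_boxes[OF assms] by (simp add: mult.commute)
  show ?AE
    using AE_box_index_positive[OF assms] AE_space
  proof eventually_elim
    case (elim x)
    have "(\<Sum>k\<in>?K. f k * indicator (grid_box \<theta> \<epsilon> k \<inter> space M) x) =
      (\<Sum>k\<in>?K. if k = box_index \<theta> \<epsilon> x then f k else 0)"
      using elim by (intro sum.cong) (auto simp: mem_grid_box_iff[OF assms(2)] indicator_def)
    then show ?case
      using elim finite_positive_boxes[OF assms] by simp
  qed
qed

section \<open>Essential bounds for ball measures and comparison with box sums\<close>

lemma ball_measure_le_1: "ball_measure M \<epsilon> x \<le> 1"
  by (simp add: ball_measure_def)

text \<open>Boxes of side \<epsilon>/n fit into the \<epsilon>-ball around each of their points.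
  Almost every point lies in one of the finitely many boxes of positive measure, and the smallest of
  these measures is the bound.\<close>

lemma AE_ball_measure_bounded_below:
  assumes "\<epsilon> > 0"
  obtains m where "m > 0" "AE x in M. m \<le> ball_measure M \<epsilon> x"
proof -
  define \<theta> :: "'n grid" where "\<theta> = (0, mat 1)"
  have \<theta>: "\<theta> \<in> grids"
    by (simp add: \<theta>_def grids_def orthogonal_matrix_id)
  define \<delta> where "\<delta> = \<epsilon> / real CARD('n)"
  have \<delta>: "\<delta> > 0" "real CARD('n) * \<delta> = \<epsilon>"
    using assms by (simp_all add: \<delta>_def)
  let ?K = "{k. box_measure M \<theta> \<delta> k > 0}"
  \<comment> \<open>The inserted 1 guarantees a nonempty set for \<open>Min\<close>.\<close>
  define m where "m = Min (insert 1 (box_measure M \<theta> \<delta> ` ?K))"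
  have fin: "finite ?K"
    by (rule finite_positive_boxes[OF \<theta> \<delta>(1)])
  have "m > 0"
    using fin by (simp add: m_def)
  moreover have "AE x in M. m \<le> ball_measure M \<epsilon> x"
    using AE_box_index_positive[OF \<theta> \<delta>(1)] AE_space
  proof eventually_elim
    case (elim x)
    have "m \<le> box_measure M \<theta> \<delta> (box_index \<theta> \<delta> x)"
      using elim fin unfolding m_def by (intro Min_le) auto
    also have "\<dots> \<le> ball_measure M \<epsilon> x"
      unfolding box_measure_def ball_measure_def
    proof (rule finite_measure_mono)
      show "grid_box \<theta> \<delta> (box_index \<theta> \<delta> x) \<inter> space M \<subseteq> ball x \<epsilon> \<inter> space M"
        using grid_box_subset_ball[OF \<theta>, of x \<delta> "box_index \<theta> \<delta> x"] \<delta>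
        by (auto simp: mem_grid_box_iff)
    qed (simp add: Int_space_sets)
    finally show ?case .
  qed
  ultimately show thesis
    by (rule that)
qed

text \<open>Almost everywhere the ball measure lies in an interval from some \<open>m > 0\<close> to
  1, so the integrand lies between \<open>\<phi> m\<close> and \<open>\<phi> 1\<close>. Monotonicity
  is asked only on positive reals, since the default values of \<open>ln\<close> and
  \<open>powr\<close> at 0 can violate it.\<close>

lemma ball_integral_bounds:
  fixes \<phi> :: "real \<Rightarrow> real"
  assumes "\<epsilon> > 0" and mono: "mono_on {0<..} \<phi>" and meas: "\<phi> \<in> borel_measurable borel"
  shows "integrable M (\<lambda>x. \<phi> (ball_measure M \<epsilon> x))"
    and "(\<integral>x. \<phi> (ball_measure M \<epsilon> x) \<partial>M) \<le> \<phi> 1"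
    and "\<exists>m>0. \<phi> m \<le> (\<integral>x. \<phi> (ball_measure M \<epsilon> x) \<partial>M)"
proof -
  obtain m where m: "m > 0" "AE x in M. m \<le> ball_measure M \<epsilon> x"
    using AE_ball_measure_bounded_below[OF assms(1)] .
  have AE: "AE x in M. \<phi> m \<le> \<phi> (ball_measure M \<epsilon> x) \<and> \<phi> (ball_measure M \<epsilon> x) \<le> \<phi> 1"
    using m(2)
  proof eventually_elim
    case (elim x)
    then show ?case
      using m(1) ball_measure_le_1[of \<epsilon> x] by (auto intro!: mono_onD[OF mono])
  qed
  then have "AE x in M. norm (\<phi> (ball_measure M \<epsilon> x)) \<le> max \<bar>\<phi> m\<bar> \<bar>\<phi> 1\<bar>"
    by eventually_elim auto
  then show int: "integrable M (\<lambda>x. \<phi> (ball_measure M \<epsilon> x))"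
    by (rule integrable_const_bound) (rule measurable_compose[OF ball_measure_borel meas])
  show "(\<integral>x. \<phi> (ball_measure M \<epsilon> x) \<partial>M) \<le> \<phi> 1"
    using AE by (intro integral_le_const[OF int]) auto
  have "\<phi> m \<le> (\<integral>x. \<phi> (ball_measure M \<epsilon> x) \<partial>M)"
    using AE by (intro integral_ge_const[OF int]) auto
  with m(1) show "\<exists>m>0. \<phi> m \<le> (\<integral>x. \<phi> (ball_measure M \<epsilon> x) \<partial>M)"
    by blast
qed

text \<open>A general \<open>\<phi>\<close> covers three cases at once: \<open>ln\<close>, the power
  for \<open>q > 1\<close>, and the negated power for \<open>q < 1\<close>.\<close>

lemma box_sum_sandwich:
  fixes \<phi> :: "real \<Rightarrow> real"
  assumes "\<theta> \<in> grids" "\<epsilon> > 0" and mono: "mono_on {0<..} \<phi>" and meas: "\<phi> \<in> borel_measurable borel"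
  defines "S \<equiv> (\<Sum>\<^sub>\<infinity>k\<in>{k. box_measure M \<theta> \<epsilon> k > 0}. box_measure M \<theta> \<epsilon> k * \<phi> (big_box_measure M \<theta> \<epsilon> k))"
  shows "(\<integral>x. \<phi> (ball_measure M \<epsilon> x) \<partial>M) \<le> S"
    and "S \<le> (\<integral>x. \<phi> (ball_measure M (2 * real CARD('n) * \<epsilon>) x) \<partial>M)"
proof -
  let ?C = "2 * real CARD('n) * \<epsilon>"
  define g where "g x = (\<Sum>k | box_measure M \<theta> \<epsilon> k > 0.
    \<phi> (big_box_measure M \<theta> \<epsilon> k) * indicator (grid_box \<theta> \<epsilon> k \<inter> space M) x)" for x
  have "has_bochner_integral M g S"
    unfolding g_def S_def by (rule has_bochner_integral_box_index(1)[OF assms(1,2)])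
  then have g: "integrable M g" "integral\<^sup>L M g = S"
    by (simp_all add: has_bochner_integral_iff)
  have "?C > 0" using assms(2) by simp
  \<comment> \<open>A positive smallest ball measure keeps all three arguments of
    \<open>\<phi>\<close> in the range where it is monotone.\<close>
  obtain m where m: "m > 0" "AE x in M. m \<le> ball_measure M \<epsilon> x"
    using AE_ball_measure_bounded_below[OF assms(2)] .
  have AE: "AE x in M. \<phi> (ball_measure M \<epsilon> x) \<le> g x \<and> g x \<le> \<phi> (ball_measure M ?C x)"
    using has_bochner_integral_box_index(2)[OF assms(1,2), of "\<lambda>k. \<phi> (big_box_measure M \<theta> \<epsilon> k)"] m(2)
  proof eventually_elim
    case (elim x)
    let ?k = "box_index \<theta> \<epsilon> x"
    have x: "x \<in> grid_box \<theta> \<epsilon> ?k"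
      using assms(2) by (simp add: mem_grid_box_iff)
    have 1: "ball_measure M \<epsilon> x \<le> big_box_measure M \<theta> \<epsilon> ?k"
      unfolding ball_measure_def big_box_measure_def
      using ball_subset_big_box[OF assms(1) x] big_box_sets[OF assms(1,2)]
      by (intro finite_measure_mono) auto
    have 2: "big_box_measure M \<theta> \<epsilon> ?k \<le> ball_measure M ?C x"
      unfolding ball_measure_def big_box_measure_def
      using big_box_subset_ball[OF assms(1) x]
      by (intro finite_measure_mono) (auto simp: Int_space_sets mult.commute mult.left_commute)
    have "g x = \<phi> (big_box_measure M \<theta> \<epsilon> ?k)"
      using elim by (simp add: g_def)
    then show ?case
      using 1 2 elim m(1) by (auto intro!: mono_onD[OF mono])
  qed
  show "(\<integral>x. \<phi> (ball_measure M \<epsilon> x) \<partial>M) \<le> S"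
    unfolding g(2)[symmetric] using AE
    by (intro integral_mono_AE g ball_integral_bounds(1)[OF assms(2) mono meas]) auto
  show "S \<le> (\<integral>x. \<phi> (ball_measure M ?C x) \<partial>M)"
    unfolding g(2)[symmetric] using AE
    by (intro integral_mono_AE g ball_integral_bounds(1)[OF \<open>?C > 0\<close> mono meas]) auto
qed

lemma Gamma_log_nonpos:
  assumes "\<epsilon> > 0"
  shows "Gamma_log M \<epsilon> \<le> 0"
  using ball_integral_bounds(2)[OF assms, of ln] by (simp add: Gamma_log_def mono_on_def)

lemma Psi_log_sandwich:
  assumes "\<theta> \<in> grids" "\<epsilon> > 0"
  shows "Gamma_log M \<epsilon> \<le> Psi_log M \<theta> \<epsilon>"
    and "Psi_log M \<theta> \<epsilon> \<le> Gamma_log M (2 * real CARD('n) * \<epsilon>)"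
  using box_sum_sandwich[OF assms, of ln] by (simp_all add: Gamma_log_def Psi_log_def mono_on_def)

text \<open>For \<open>q < 1\<close> the power is decreasing, but the prefactor
  \<open>1 / (q - 1)\<close> is negative as well; the two reversals cancel, and the inequalities
  have the same form as for \<open>q > 1\<close>.\<close>

lemma Psi_sum_sandwich:
  assumes "\<theta> \<in> grids" "\<epsilon> > 0" "q \<noteq> 1"
  shows "1 / (q - 1) * ln (Gamma_corr M \<epsilon> q) \<le> 1 / (q - 1) * ln (Psi_sum M \<theta> \<epsilon> q)"
    and "1 / (q - 1) * ln (Psi_sum M \<theta> \<epsilon> q) \<le> 1 / (q - 1) * ln (Gamma_corr M (2 * real CARD('n) * \<epsilon>) q)"
    and "1 / (q - 1) * ln (Gamma_corr M \<epsilon> q) \<le> 0"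
proof -
  let ?C = "2 * real CARD('n) * \<epsilon>"
  have C: "?C > 0" using assms(2) by simp
  consider "q > 1" | "q < 1" using assms(3) by linarith
  then have "1 / (q - 1) * ln (Gamma_corr M \<epsilon> q) \<le> 1 / (q - 1) * ln (Psi_sum M \<theta> \<epsilon> q) \<and>
    1 / (q - 1) * ln (Psi_sum M \<theta> \<epsilon> q) \<le> 1 / (q - 1) * ln (Gamma_corr M ?C q) \<and>
    1 / (q - 1) * ln (Gamma_corr M \<epsilon> q) \<le> 0"
  proof cases
    case 1
    define \<phi> where "\<phi> t = t powr (q - 1)" for t :: real
    have \<phi>: "mono_on {0<..} \<phi>" "\<phi> \<in> borel_measurable borel"
      using 1 unfolding \<phi>_def by (auto simp: mono_on_def powr_mono2)
    \<comment> \<open>Strict positivity is needed for the monotonicity of \<open>ln\<close>, whose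
      value at 0 is a convention; it follows from the lower bound
      \<open>m powr (q - 1)\<close>.\<close>
    have "Gamma_corr M \<epsilon> q > 0"
      using ball_integral_bounds(3)[OF assms(2) \<phi>] by (force simp: Gamma_corr_def \<phi>_def intro: less_le_trans[rotated])
    moreover have "Gamma_corr M \<epsilon> q \<le> 1"
      using ball_integral_bounds(2)[OF assms(2) \<phi>] by (simp add: Gamma_corr_def \<phi>_def)
    moreover have "Gamma_corr M \<epsilon> q \<le> Psi_sum M \<theta> \<epsilon> q" "Psi_sum M \<theta> \<epsilon> q \<le> Gamma_corr M ?C q"
      using box_sum_sandwich[OF assms(1,2) \<phi>] by (simp_all add: Gamma_corr_def Psi_sum_def \<phi>_def)
    ultimately show ?thesis
      using 1 by (auto intro!: divide_right_mono divide_nonpos_pos)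
  next
    case 2
    define \<phi> where "\<phi> t = - (t powr (q - 1))" for t :: real
    have \<phi>: "mono_on {0<..} \<phi>" "\<phi> \<in> borel_measurable borel"
      using 2 unfolding \<phi>_def by (auto simp: mono_on_def powr_mono2')
    \<comment> \<open>Here \<open>\<phi> 1 = -1\<close>, so the upper bound for the integral of
      \<open>\<phi>\<close> becomes a lower bound for the correlation integral. It gives both
      positivity and the sign of the logarithm.\<close>
    have "Gamma_corr M \<epsilon> q \<ge> 1" "Gamma_corr M ?C q \<ge> 1"
      using ball_integral_bounds(2)[OF assms(2) \<phi>] ball_integral_bounds(2)[OF C \<phi>]
      by (simp_all add: Gamma_corr_def \<phi>_def)
    moreover have "Gamma_corr M ?C q \<le> Psi_sum M \<theta> \<epsilon> q" "Psi_sum M \<theta> \<epsilon> q \<le> Gamma_corr M \<epsilon> q"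
      using box_sum_sandwich[OF assms(1,2) \<phi>]
      by (simp_all add: Gamma_corr_def Psi_sum_def \<phi>_def infsum_uminus)
    ultimately show ?thesis
      using 2 by (auto intro!: divide_right_mono_neg divide_nonneg_neg)
  qed
  then show "1 / (q - 1) * ln (Gamma_corr M \<epsilon> q) \<le> 1 / (q - 1) * ln (Psi_sum M \<theta> \<epsilon> q)"
    and "1 / (q - 1) * ln (Psi_sum M \<theta> \<epsilon> q) \<le> 1 / (q - 1) * ln (Gamma_corr M ?C q)"
    and "1 / (q - 1) * ln (Gamma_corr M \<epsilon> q) \<le> 0"
    by blast+
qed

end

section \<open>Generalized dimensions\<close>

theorem theorem1:
  fixes X :: "(real^'n) set" and M :: "(real^'n) measure" and T :: "real^'n \<Rightarrow> real^'n"
  assumes "compact X"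
    and "space M = X"
    and "prob_space M"
    and "\<And>x \<epsilon>. x \<in> X \<Longrightarrow> \<epsilon> > 0 \<Longrightarrow> ball x \<epsilon> \<inter> X \<in> sets M"
    and "\<And>\<theta> \<epsilon> k. \<theta> \<in> grids \<Longrightarrow> \<epsilon> > 0 \<Longrightarrow> grid_box \<theta> \<epsilon> k \<inter> X \<in> sets M"
    and "measure_preserving M T"
    and "ergodic M T"
  shows "\<forall>\<theta>\<in>grids.
    (\<forall>q. q \<noteq> 1 \<longrightarrow>
       upper_dim M q =
         Limsup (at_right 0) (\<lambda>\<epsilon>. ereal (1 / (q - 1) * (ln (Psi_sum M \<theta> \<epsilon> q) / ln \<epsilon>))) \<and>
       lower_dim M q =
         Liminf (at_right 0) (\<lambda>\<epsilon>. ereal (1 / (q - 1) * (ln (Psi_sum M \<theta> \<epsilon> q) / ln \<epsilon>)))) \<and>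
    upper_dim M 1 = Limsup (at_right 0) (\<lambda>\<epsilon>. ereal (Psi_log M \<theta> \<epsilon> / ln \<epsilon>)) \<and>
    lower_dim M 1 = Liminf (at_right 0) (\<lambda>\<epsilon>. ereal (Psi_log M \<theta> \<epsilon> / ln \<epsilon>))"
proof -
  interpret prob_space M by fact
  interpret box_prob_space M
    using assms by unfold_locales auto
  have C: "2 * real CARD('n) \<ge> 1"
    using zero_less_card_finite[where 'a = 'n] by linarith
  show ?thesis
  proof (intro ballI conjI allI impI)
    fix \<theta> :: "'n grid" and q :: real
    assume \<theta>: "\<theta> \<in> grids"
    note log_sandwich = log_rate_sandwich[OF C, of "Gamma_log M" "Psi_log M \<theta>",
        OF Psi_log_sandwich[OF \<theta>] Gamma_log_nonpos]
    show "upper_dim M 1 = Limsup (at_right 0) (\<lambda>\<epsilon>. ereal (Psi_log M \<theta> \<epsilon> / ln \<epsilon>))"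
      using log_sandwich(1) by (simp add: upper_dim_def)
    show "lower_dim M 1 = Liminf (at_right 0) (\<lambda>\<epsilon>. ereal (Psi_log M \<theta> \<epsilon> / ln \<epsilon>))"
      using log_sandwich(2) by (simp add: lower_dim_def)
    assume q: "q \<noteq> 1"
    \<comment> \<open>The prefactor is kept inside the two compared functions, which makes the first
      one nonpositive for either sign of \<open>q - 1\<close>.\<close>
    note sum_sandwich = log_rate_sandwich[OF C,
        of "\<lambda>\<epsilon>. 1 / (q - 1) * ln (Gamma_corr M \<epsilon> q)" "\<lambda>\<epsilon>. 1 / (q - 1) * ln (Psi_sum M \<theta> \<epsilon> q)",
        OF Psi_sum_sandwich[OF \<theta> _ q]]
    show "upper_dim M q =
        Limsup (at_right 0) (\<lambda>\<epsilon>. ereal (1 / (q - 1) * (ln (Psi_sum M \<theta> \<epsilon> q) / ln \<epsilon>)))"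
      using sum_sandwich(1) q by (simp add: upper_dim_def)
    show "lower_dim M q =
        Liminf (at_right 0) (\<lambda>\<epsilon>. ereal (1 / (q - 1) * (ln (Psi_sum M \<theta> \<epsilon> q) / ln \<epsilon>)))"
      using sum_sandwich(2) q by (simp add: lower_dim_def)
  qed
qed

end
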